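(* Let $G=(V,E)$ be a bipartite graph, regarded as a position of the odd/odd vertex removal game. Then its Grundy value is $$g(G)=\begin{cases}1 & \text{if } |E| \text{ is odd},\\ 0 & \text{if } |E| \text{ is even}.\end{cases}$$
   Context: All graphs are finite, simple and undirected. The odd/odd vertex removal game is the following impartial two-player game. A position is a graph. A move from a graph $G$ consists of choosing a vertex $v$ of odd degree in $G$ and removing $v$ together with all edges incident to it, giving the graph $G-v$. The players alternate moves, both players have the same available moves, and a player who cannot move loses. The Grundy (Sprague-Grundy) value $g(G)$ of a position is defined recursively by $g(G)=\operatorname{mex}\{g(G-v) : v \text{ a vertex of odd degree in } G\}$, where $\operatorname{mex}(A)$ denotes the smallest nonnegative integer not in the set $A$ (so $g(G)=0$ if $G$ has no vertex of odd degree). A graph is bipartite if every closed trail in it has even length (equivalently, its vertex set can be partitioned into two sets with no edge inside either set). *)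

theory Defs
  imports Main
begin

text \<open>A finite simple undirected graph is given by its vertex set and its set of edges,
  where an edge is a two-element set of vertices.\<close>

definition simple_graph :: "'a set \<Rightarrow> 'a set set \<Rightarrow> bool" where
  "simple_graph V E \<longleftrightarrow> finite V \<and> (\<forall>e\<in>E. e \<subseteq> V \<and> card e = 2)"

definition degree :: "'a set set \<Rightarrow> 'a \<Rightarrow> nat" where
  "degree E v = card {e \<in> E. v \<in> e}"

definition delete_vertex_edges :: "'a set set \<Rightarrow> 'a \<Rightarrow> 'a set set" where
  "delete_vertex_edges E v = {e \<in> E. v \<notin> e}"

definition odd_vertices :: "'a set \<Rightarrow> 'a set set \<Rightarrow> 'a set" where
  "odd_vertices V E = {v \<in> V. odd (degree E v)}"

text \<open>Walks are represented by their vertex lists; the length of a walk is its number of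
  edges, so a list \<open>[v]\<close> is a (closed) walk of length 0.\<close>

fun walk_edges :: "'a list \<Rightarrow> 'a set list" where
  "walk_edges (u # v # vs) = {u, v} # walk_edges (v # vs)"
| "walk_edges _ = []"

definition closed_trail :: "'a set \<Rightarrow> 'a set set \<Rightarrow> 'a list \<Rightarrow> bool" where
  "closed_trail V E vs \<longleftrightarrow>
     vs \<noteq> [] \<and> set vs \<subseteq> V \<and> set (walk_edges vs) \<subseteq> E \<and>
     distinct (walk_edges vs) \<and> hd vs = last vs"

definition bipartite :: "'a set \<Rightarrow> 'a set set \<Rightarrow> bool" where
  "bipartite V E \<longleftrightarrow> (\<forall>vs. closed_trail V E vs \<longrightarrow> even (length (walk_edges vs)))"

definition mex :: "nat set \<Rightarrow> nat" where
  "mex A = (LEAST n. n \<notin> A)"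

text \<open>The test \<open>finite V\<close> only serves to make the recursion terminate on all arguments; the
  value for infinite \<open>V\<close> is a dummy.\<close>

function grundy :: "'a set \<Rightarrow> 'a set set \<Rightarrow> nat" where
  "grundy V E =
     (if finite V
      then mex ((\<lambda>v. grundy (V - {v}) (delete_vertex_edges E v)) ` odd_vertices V E)
      else 0)"
  by pat_completeness auto
termination
  by (relation "measure (\<lambda>(V, E). card V)")
     (auto simp: odd_vertices_def simp del: card_Diff_singleton card_Diff_insert intro: card_Diff1_less)

declare grundy.simps [simp del]

end

theory Submission
  imports Defs
begin

text \<open>Deleting a vertex of odd degree flips the parity of the number of edges, so by induction
  all options of a position have the same value, and it only remains to find a move when the number
  of edges is odd. If there were none, all degrees would be even; then a longest trail is closed
  (otherwise it uses an odd number of the edges at its end vertex and could be extended), so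
  the edge set splits into closed trails, each of even length in a bipartite graph.\<close>

lemma simple_graph_finite_edges:
  assumes "simple_graph V E"
  shows "finite E"
proof (rule finite_subset)
  show "E \<subseteq> Pow V" "finite (Pow V)"
    using assms by (auto simp: simple_graph_def)
qed

lemma degree_insert:
  assumes "finite A" "e \<notin> A"
  shows "degree (insert e A) x = degree A x + (if x \<in> e then 1 else 0)"
proof -
  have "{f \<in> insert e A. x \<in> f} = (if x \<in> e then insert e {f \<in> A. x \<in> f} else {f \<in> A. x \<in> f})"
    by auto
  then show ?thesis
    using assms by (simp add: degree_def)
qed

lemma degree_Diff:
  assumes "finite E" "A \<subseteq> E"
  shows "degree E x = degree (E - A) x + degree A x"
proof -
  have "{e \<in> E. x \<in> e} = {e \<in> E - A. x \<in> e} \<union> {e \<in> A. x \<in> e}"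
    using assms by auto
  moreover have "card ({e \<in> E - A. x \<in> e} \<union> {e \<in> A. x \<in> e})
      = card {e \<in> E - A. x \<in> e} + card {e \<in> A. x \<in> e}"
    using assms by (intro card_Un_disjoint) (auto dest: finite_subset)
  ultimately show ?thesis
    by (simp add: degree_def)
qed

text \<open>Prepending \<open>u\<close> to a trail that starts at \<open>v\<close> adds one edge and
  so flips the parity at \<open>u\<close> and \<open>v\<close> only: the odd mark moves from the old
  head to the new one. Cardinality 2 forces \<open>u \<noteq> v\<close>; a one-vertex trail has no
  edges and equal ends.\<close>

lemma odd_degree_trail_iff:
  assumes "vs \<noteq> []" "distinct (walk_edges vs)" "\<forall>e\<in>set (walk_edges vs). card e = 2"
  shows "odd (degree (set (walk_edges vs)) x) \<longleftrightarrow> (x = hd vs) \<noteq> (x = last vs)"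
  using assms
proof (induction vs rule: walk_edges.induct)
  case (1 u v vs)
  have "u \<noteq> v"
    using "1.prems"(3) by auto
  moreover have "odd (degree (set (walk_edges (v # vs))) x) \<longleftrightarrow> (x = v) \<noteq> (x = last (v # vs))"
    using 1 by simp
  moreover have "degree (set (walk_edges (u # v # vs))) x
      = degree (set (walk_edges (v # vs))) x + (if x = u \<or> x = v then 1 else 0)"
    using "1.prems"(2) by (simp add: degree_insert)
  ultimately show ?case
    by auto
qed (auto simp: degree_def)

lemma bipartite_subgraph:
  assumes "bipartite V E" "V' \<subseteq> V" "E' \<subseteq> E"
  shows "bipartite V' E'"
  using assms unfolding bipartite_def closed_trail_def by blast

lemma even_degrees_closed_trail:
  assumes graph: "simple_graph V E" and even: "\<forall>v\<in>V. even (degree E v)" and "E \<noteq> {}"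
  obtains vs where "closed_trail V E vs" "walk_edges vs \<noteq> []"
proof -
  define trail where "trail vs \<longleftrightarrow> vs \<noteq> [] \<and> set vs \<subseteq> V \<and> set (walk_edges vs) \<subseteq> E
      \<and> distinct (walk_edges vs)" for vs
  have fin: "finite E"
    using graph by (rule simple_graph_finite_edges)
  obtain e where "e \<in> E"
    using \<open>E \<noteq> {}\<close> by blast
  moreover obtain a b where "e = {a, b}"
    using graph \<open>e \<in> E\<close> by (auto simp: simple_graph_def card_2_iff)
  \<comment> \<open>This one-edge trail shows that trails exist and, by comparison, that a longest
    one has an edge.\<close>
  ultimately have ab: "trail [a, b]"
    using graph by (auto simp: trail_def simple_graph_def)
  \<comment> \<open>Edges of a trail do not repeat, so lengths are bounded and a longest trail
    exists.\<close>
  have bound: "length (walk_edges vs) < Suc (card E)" if "trail vs" for vs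
  proof -
    have "length (walk_edges vs) = card (set (walk_edges vs))"
      using that by (simp add: trail_def distinct_card)
    also have "\<dots> \<le> card E"
      using that by (intro card_mono fin) (simp add: trail_def)
    finally show ?thesis
      by simp
  qed
  obtain vs where vs: "trail vs"
    and max: "\<And>us. trail us \<Longrightarrow> length (walk_edges us) \<le> length (walk_edges vs)"
    using ex_has_greatest_nat[of trail, OF ab, of "\<lambda>vs. length (walk_edges vs)" "Suc (card E)"] bound
    by (auto dest: less_imp_le)
  define A where "A = set (walk_edges vs)"
  have "A \<subseteq> E"
    using vs by (simp add: A_def trail_def)
  have "hd vs = last vs"
  proof (rule ccontr)
    assume ne: "hd vs \<noteq> last vs"
    have "odd (degree A (hd vs))"
      unfolding A_def using vs graph ne
      by (subst odd_degree_trail_iff) (auto simp: trail_def simple_graph_def)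
    moreover have "even (degree E (hd vs))"
      using even vs hd_in_set by (auto simp: trail_def)
    ultimately have "odd (degree (E - A) (hd vs))"
      using degree_Diff[OF fin \<open>A \<subseteq> E\<close>] by simp
    then have "{f \<in> E - A. hd vs \<in> f} \<noteq> {}"
      by (metis card.empty degree_def even_zero)
    then obtain f where f: "f \<in> E" "f \<notin> A" "hd vs \<in> f"
      by blast
    have "f \<subseteq> V" "card f = 2"
      using graph f(1) by (auto simp: simple_graph_def)
    then obtain w where w: "f = {w, hd vs}" "w \<in> V"
      using f(3) by (auto simp: card_2_iff insert_commute)
    \<comment> \<open>The extension is made at the head because \<open>walk_edges\<close> recurses
      from the front; \<open>f \<notin> A\<close> keeps the edges distinct.\<close>
    have edges: "walk_edges (w # vs) = f # walk_edges vs"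
      using vs w by (cases vs) (auto simp: trail_def)
    then have "trail (w # vs)"
      using vs f w by (auto simp: trail_def A_def)
    then show False
      using max[of "w # vs"] edges by simp
  qed
  then have "closed_trail V E vs"
    using vs by (simp add: trail_def closed_trail_def)
  moreover have "walk_edges vs \<noteq> []"
    using max[OF ab] by auto
  ultimately show thesis
    by (rule that)
qed

lemma bipartite_even_degrees_even_card:
  assumes "simple_graph V E" "bipartite V E" "\<forall>v\<in>V. even (degree E v)"
  shows "even (card E)"
  using assms
proof (induction "card E" arbitrary: E rule: less_induct)
  case less
  have fin: "finite E"
    using less.prems(1) by (rule simple_graph_finite_edges)
  show ?case
  proof (cases "E = {}")
    case False
    then obtain vs where vs: "closed_trail V E vs" "walk_edges vs \<noteq> []"
      using less.prems even_degrees_closed_trail by blast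
    define A where "A = set (walk_edges vs)"
    have A: "A \<subseteq> E" "A \<noteq> {}"
      using vs by (auto simp: A_def closed_trail_def)
    have card: "card E = card (E - A) + card A"
      using A fin by (metis card_Diff_subset card_mono finite_subset le_add_diff_inverse2)
    have "card A > 0"
      using A fin by (meson card_gt_0_iff finite_subset)
    \<comment> \<open>In a closed trail head and last vertex coincide, so no vertex has odd degree
      in \<open>A\<close>; removing \<open>A\<close> thus preserves the evenness of all degrees, as
      the induction requires.\<close>
    have "even (degree A v)" for v
      unfolding A_def using vs less.prems(1) odd_degree_trail_iff[of vs v]
      by (auto simp: closed_trail_def simple_graph_def)
    then have "\<forall>v\<in>V. even (degree (E - A) v)"
      using less.prems(3) degree_Diff[OF fin A(1)] by simp
    moreover have "simple_graph V (E - A)"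
      using less.prems(1) by (simp add: simple_graph_def)
    moreover have "bipartite V (E - A)"
      using less.prems(2) by (rule bipartite_subgraph) auto
    ultimately have "even (card (E - A))"
      using less.hyps card \<open>card A > 0\<close> by simp
    \<comment> \<open>Bipartiteness enters here: the length of the trail is even, and it equals
      \<open>card A\<close> since the edges are distinct.\<close>
    moreover have "even (card A)"
      using vs(1) less.prems(2) by (auto simp: A_def bipartite_def closed_trail_def distinct_card)
    ultimately show ?thesis
      using card by simp
  qed simp
qed

theorem theorem6:
  fixes V :: "'a set" and E :: "'a set set"
  assumes "simple_graph V E"
    and "bipartite V E"
  shows "grundy V E = (if odd (card E) then 1 else 0)"
  using assms
proof (induction "card V" arbitrary: V E rule: less_induct)
  case less
  have finV: "finite V"
    using less.prems(1) by (simp add: simple_graph_def)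
  have finE: "finite E"
    using less.prems(1) by (rule simple_graph_finite_edges)
  have options: "grundy (V - {v}) (delete_vertex_edges E v) = (if odd (card E) then 0 else 1)"
    if v: "v \<in> odd_vertices V E" for v
  proof -
    have "v \<in> V" and odd: "odd (degree E v)"
      using v by (auto simp: odd_vertices_def)
    have "card (V - {v}) < card V"
      using finV \<open>v \<in> V\<close> by (rule card_Diff1_less)
    moreover have "simple_graph (V - {v}) (delete_vertex_edges E v)"
      using less.prems(1) by (auto simp: simple_graph_def delete_vertex_edges_def)
    moreover have "bipartite (V - {v}) (delete_vertex_edges E v)"
      using less.prems(2) by (rule bipartite_subgraph) (auto simp: delete_vertex_edges_def)
    ultimately have "grundy (V - {v}) (delete_vertex_edges E v)
        = (if odd (card (delete_vertex_edges E v)) then 1 else 0)"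
      by (rule less.hyps)
    \<comment> \<open>Counting the edges that avoid \<open>v\<close> and those through
      \<open>v\<close> separately shows that a move removes exactly \<open>degree E v\<close> edges,
      an odd number.\<close>
    moreover have "E = delete_vertex_edges E v \<union> {e \<in> E. v \<in> e}"
      by (auto simp: delete_vertex_edges_def)
    then have "card E = card (delete_vertex_edges E v) + degree E v"
      unfolding degree_def using finE
      by (metis (no_types, lifting) card_Un_disjoint delete_vertex_edges_def disjoint_iff
          finite_Un mem_Collect_eq)
    ultimately show ?thesis
      using odd by simp
  qed
  show ?case
  proof (cases "odd (card E)")
    case True
    \<comment> \<open>Without a move all degrees would be even, hence \<open>card E\<close> too.
      Existence of \<open>w\<close> makes the set of option values exactly \<open>{0}\<close> rather
      than empty.\<close>
    then obtain w where "w \<in> odd_vertices V E"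
      using less.prems bipartite_even_degrees_even_card by (auto simp: odd_vertices_def)
    then have "(\<lambda>v. grundy (V - {v}) (delete_vertex_edges E v)) ` odd_vertices V E = {0}"
      using options True by force
    moreover have "mex {0} = 1"
      unfolding mex_def by (rule Least_equality) auto
    ultimately show ?thesis
      using True finV by (subst grundy.simps) simp
  next
    case False
    \<comment> \<open>Every option has value 1, if there is any; in either case 0 is missing, so no
      move has to be exhibited.\<close>
    then have "0 \<notin> (\<lambda>v. grundy (V - {v}) (delete_vertex_edges E v)) ` odd_vertices V E"
      using options by auto
    then have "mex ((\<lambda>v. grundy (V - {v}) (delete_vertex_edges E v)) ` odd_vertices V E) = 0"
      unfolding mex_def by simp
    then show ?thesis
      using False finV by (subst grundy.simps) simp
  qed
qed

end
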